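(* Let $k=(k_1,k_2,k_3)\in\mathbb{Z}_{>0}^3$, let $j\ge 0$ be an even integer, and let $$p=p_{j,(k_1+1,k_2+1)}(r_1,r_2)=\sum_{i=0}^{j/2}(-1)^i\binom{j/2}{i}(k_1+j/2)_i\,(k_2+j/2)_{j/2-i}\;r_1^{j/2-i}r_2^{i},$$ where $(x)_n=x(x-1)\cdots(x-n+1)$, regarded as an element of $\mathbb{C}[r_1,r_2,r_3]$. Then $\mathbf{M}_kp$ is a Rankin–Cohen polynomial of weight $(j+2,1)$ and type $k=(k_1,k_2,k_3)$; that is, $\mathbf{M}_kp\in H_{j+2}\otimes_{\mathbb{C}}R_3$ is $\rho$-homogeneous for $\rho=\mathrm{Sym}^{j+2}(\mathrm{St})\otimes\det(\mathrm{St})$ and $k$-harmonic.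
   Context: Here $H_j\subset\mathbb{C}[x,y]$ is the space of homogeneous polynomials of degree $j$ in $x,y$, and $R_t=\mathbb{C}[\mathbf{r}^s_{ij}\mid 1\le i\le j\le 2,\ 1\le s\le t]$. Write elements of $H_j\otimes_{\mathbb{C}}R_t$ as $P(\mathbf{r}^1,\dots,\mathbf{r}^t;v)$, where $\mathbf{r}^s=\begin{pmatrix}\mathbf{r}^s_{11}&\mathbf{r}^s_{12}\\\mathbf{r}^s_{12}&\mathbf{r}^s_{22}\end{pmatrix}$ and $v=(x,y)'$ (prime denotes transpose). $\mathrm{St}$ is the standard representation of $\mathrm{GL}(2,\mathbb{C})$, and $(j,\ell)$ abbreviates $\mathrm{Sym}^j(\mathrm{St})\otimes\det^\ell(\mathrm{St})$. *$\rho$-homogeneous.* For $\rho=(j,\ell)$, $P\in H_j\otimes R_t$ is $\rho$-homogeneous if $P(G\mathbf{r}^1G',\dots,G\mathbf{r}^tG';v)=\det(G)^\ell P(\mathbf{r}^1,\dots,\mathbf{r}^t;G'v)$ for all $G\in\mathrm{GL}(2,\mathbb{C})$. *$k$-harmonic.* For a type $k=(k_1,\dots,k_t)\in\mathbb{Z}_{>0}^t$, let $\xi^s=(\xi^s_{ij})$ be a $2\times 2k_s$ matrix of indeterminates for each $s$, and set $\tilde P=P(\xi^1{\xi^1}',\dots,\xi^t{\xi^t}';v)$. Then $P$ is $k$-harmonic if $\Delta\tilde P=\sum_{s=1}^t\sum_{i=1}^{2}\sum_{j=1}^{2k_s}\frac{\partial^2\tilde P}{(\partial\xi^s_{ij})^2}=0$.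 A polynomial in $H_j\otimes R_t$ that is both $\rho$-homogeneous (with $\rho=(j,\ell)$) and $k$-harmonic is called a Rankin–Cohen (RC) polynomial of weight $(j,\ell)$ and type $k$. *The operator $\mathbf{M}_k$.* For symmetric $2\times2$ matrices put $A[v]=v'Av$ and $A\times B=AJB-BJA$ with $J=\begin{pmatrix}0&1\\-1&0\end{pmatrix}$. For $q\in\mathbb{C}[r_1,r_2,r_3]$ let $\Psi(q)=q(\mathbf{r}^1[v],\mathbf{r}^2[v],\mathbf{r}^3[v])$. Then $\mathbf{M}_k:\mathbb{C}[r_1,r_2,r_3]\to\bigoplus_jH_j\otimes_{\mathbb{C}}R_3$ is defined by $$\mathbf{M}_kq=(\mathbf{r}^1\times\mathbf{r}^2)[v]\,\Psi\bigl(k_3q+r_3\tfrac{\partial q}{\partial r_3}\bigr)-(\mathbf{r}^1\times\mathbf{r}^3)[v]\,\Psi\bigl(k_2q+r_2\tfrac{\partial q}{\partial r_2}\bigr)+(\mathbf{r}^2\times\mathbf{r}^3)[v]\,\Psi\bigl(k_1q+r_1\tfrac{\partial q}{\partial r_1}\bigr).$$ *)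

theory Defs
  imports "HOL-Analysis.Analysis" "HOL-Library.Poly_Mapping"
begin

section \<open>Multivariate polynomials over the complex numbers\<close>

text \<open>
  Polynomials with indeterminates in \<open>'x\<close> are finitely supported functions from monomials (exponent
  vectors of finite support) to coefficients. The ring structure is the one of
  \<^theory>\<open>HOL-Library.Poly_Mapping\<close>, whose product is convolution.
\<close>

type_synonym 'x cpoly = "('x \<Rightarrow>\<^sub>0 nat) \<Rightarrow>\<^sub>0 complex"

definition Const :: "complex \<Rightarrow> 'x cpoly" where
  "Const c = Poly_Mapping.single 0 c"

definition Indet :: "'x \<Rightarrow> 'x cpoly" where
  "Indet a = Poly_Mapping.single (Poly_Mapping.single a 1) 1"

definition psubst :: "('x \<Rightarrow> 'y cpoly) \<Rightarrow> 'x cpoly \<Rightarrow> 'y cpoly" where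
  "psubst \<sigma> p =
     (\<Sum>m\<in>Poly_Mapping.keys p. Const (Poly_Mapping.lookup p m) *
        (\<Prod>a\<in>Poly_Mapping.keys m. \<sigma> a ^ Poly_Mapping.lookup m a))"

text \<open>The formal partial derivative; where the exponent of \<open>a\<close> in \<open>m\<close> is 0, the truncated
  subtraction is harmless, because the coefficient vanishes.\<close>

definition pdiff :: "'x \<Rightarrow> 'x cpoly \<Rightarrow> 'x cpoly" where
  "pdiff a p =
     (\<Sum>m\<in>Poly_Mapping.keys p. Poly_Mapping.single (m - Poly_Mapping.single a 1)
        (of_nat (Poly_Mapping.lookup m a) * Poly_Mapping.lookup p m))"


section \<open>Rankin--Cohen polynomials\<close>

text \<open>
  The indices \<open>s = 1, \<dots>, t\<close> are the elements of a finite type \<open>'t\<close> with \<open>t\<close> elements; a type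
  \<open>k\<close> is then a vector in \<open>nat ^ 't\<close>. The ring \<open>\<complex>[x,y] \<otimes> R\<^sub>t\<close>, the direct sum of all
  \<open>H\<^sub>j \<otimes> R\<^sub>t\<close>, is identified with the polynomial ring in \<open>x\<close>, \<open>y\<close> and the entries of the
  symmetric matrices \<open>r\<^sup>s\<close>; only the entries on and above the diagonal are indeterminates.
\<close>

datatype 't rvar = VarX | VarY | R11 't | R12 't | R22 't

definition vvec :: "'t rvar cpoly ^ 2" where
  "vvec = vector [Indet VarX, Indet VarY]"

definition rmat :: "'t \<Rightarrow> 't rvar cpoly ^ 2 ^ 2" where
  "rmat s = vector [vector [Indet (R11 s), Indet (R12 s)],
                    vector [Indet (R12 s), Indet (R22 s)]]"

definition HR :: "nat \<Rightarrow> 't rvar cpoly set" where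
  "HR j = {P. \<forall>m\<in>Poly_Mapping.keys P. Poly_Mapping.lookup m VarX + Poly_Mapping.lookup m VarY = j}"

text \<open>\<open>subst_rv A w P\<close> is \<open>P(A\<^sup>1, \<dots>, A\<^sup>t; w)\<close>; it is meant for symmetric matrices \<open>A\<^sup>s\<close>.\<close>

definition subst_rv ::
  "('t \<Rightarrow> 'y cpoly ^ 2 ^ 2) \<Rightarrow> 'y cpoly ^ 2 \<Rightarrow> 't rvar cpoly \<Rightarrow> 'y cpoly" where
  "subst_rv A w = psubst (\<lambda>a. case a of
       VarX \<Rightarrow> w $ 1 | VarY \<Rightarrow> w $ 2
     | R11 s \<Rightarrow> A s $ 1 $ 1 | R12 s \<Rightarrow> A s $ 1 $ 2 | R22 s \<Rightarrow> A s $ 2 $ 2)"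

definition Const_mat :: "complex ^ 2 ^ 2 \<Rightarrow> 'y cpoly ^ 2 ^ 2" where
  "Const_mat G = (\<chi> i j. Const (G $ i $ j))"

text \<open>The weight \<open>(j, l)\<close> stands for the representation \<open>Sym\<^sup>j(St) \<otimes> det\<^sup>l(St)\<close> of \<open>GL(2,\<complex>)\<close>.\<close>

definition rho_homogeneous :: "nat \<Rightarrow> int \<Rightarrow> 't rvar cpoly \<Rightarrow> bool" where
  "rho_homogeneous j l P \<longleftrightarrow> P \<in> HR j \<and>
     (\<forall>G :: complex ^ 2 ^ 2. invertible G \<longrightarrow>
        subst_rv (\<lambda>s. Const_mat G ** rmat s ** transpose (Const_mat G)) vvec P =
        Const (det G powi l) * subst_rv rmat (transpose (Const_mat G) *v vvec) P)"

text \<open>The indeterminates of \<open>P(\<xi>\<^sup>1 (\<xi>\<^sup>1)', \<dots>, \<xi>\<^sup>t (\<xi>\<^sup>t)'; v)\<close>: besides \<open>x\<close> and \<open>y\<close>, the entries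
  \<open>Xi s i j\<close> of the \<open>2 \<times> 2k\<^sub>s\<close> matrices \<open>\<xi>\<^sup>s\<close>. The column index \<open>j\<close> runs over \<open>{1..2k\<^sub>s}\<close>.\<close>

datatype 't xivar = XiX | XiY | Xi 't 2 nat

definition xi_gram :: "nat ^ 't \<Rightarrow> 't \<Rightarrow> 't xivar cpoly ^ 2 ^ 2" where
  "xi_gram k s = (\<chi> a b. \<Sum>j = 1..2 * k $ s. Indet (Xi s a j) * Indet (Xi s b j))"

definition xi_pullback :: "nat ^ 't \<Rightarrow> 't rvar cpoly \<Rightarrow> 't xivar cpoly" where
  "xi_pullback k = subst_rv (xi_gram k) (vector [Indet XiX, Indet XiY])"

definition xi_laplacian :: "nat ^ 't::finite \<Rightarrow> 't xivar cpoly \<Rightarrow> 't xivar cpoly" where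
  "xi_laplacian k Q =
     (\<Sum>s\<in>UNIV. \<Sum>i\<in>UNIV. \<Sum>j = 1..2 * k $ s. pdiff (Xi s i j) (pdiff (Xi s i j) Q))"

definition k_harmonic :: "nat ^ 't::finite \<Rightarrow> 't rvar cpoly \<Rightarrow> bool" where
  "k_harmonic k P \<longleftrightarrow> xi_laplacian k (xi_pullback k P) = 0"

definition RC_polynomial :: "nat \<Rightarrow> int \<Rightarrow> nat ^ 't::finite \<Rightarrow> 't rvar cpoly \<Rightarrow> bool" where
  "RC_polynomial j l k P \<longleftrightarrow> rho_homogeneous j l P \<and> k_harmonic k P"


section \<open>The operator \<open>M\<^sub>k\<close>\<close>

definition qform :: "'y cpoly ^ 2 ^ 2 \<Rightarrow> 'y cpoly ^ 2 \<Rightarrow> 'y cpoly" where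
  "qform A v = (\<Sum>i\<in>UNIV. v $ i * (A *v v) $ i)"

definition Jmat :: "'y cpoly ^ 2 ^ 2" where
  "Jmat = vector [vector [0, 1], vector [-1, 0]]"

definition mcross :: "'y cpoly ^ 2 ^ 2 \<Rightarrow> 'y cpoly ^ 2 ^ 2 \<Rightarrow> 'y cpoly ^ 2 ^ 2" where
  "mcross A B = A ** Jmat ** B - B ** Jmat ** A"

text \<open>\<open>\<complex>[r\<^sub>1, r\<^sub>2, r\<^sub>3]\<close> is the type \<^typ>\<open>3 cpoly\<close>, with \<open>r\<^sub>s\<close> the indeterminate of index \<open>s :: 3\<close>
  (where \<open>3 = 0\<close>).\<close>

definition Psi :: "3 cpoly \<Rightarrow> 3 rvar cpoly" where
  "Psi = psubst (\<lambda>s. qform (rmat s) vvec)"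

definition Mop :: "nat ^ 3 \<Rightarrow> 3 cpoly \<Rightarrow> 3 rvar cpoly" where
  "Mop k q =
     (let D = (\<lambda>s. of_nat (k $ s) * q + Indet s * pdiff s q);
          C = (\<lambda>s s'. qform (mcross (rmat s) (rmat s')) vvec)
      in C 1 2 * Psi (D 3) - C 1 3 * Psi (D 2) + C 2 3 * Psi (D 1))"

definition ffact :: "'a::comm_ring_1 \<Rightarrow> nat \<Rightarrow> 'a" where
  "ffact x n = (\<Prod>i<n. x - of_nat i)"

text \<open>\<open>p_shift j k\<^sub>1 k\<^sub>2\<close> is \<open>p\<close> with index \<open>j, (k\<^sub>1 + 1, k\<^sub>2 + 1)\<close>, for even \<open>j\<close>.\<close>

definition p_shift :: "nat \<Rightarrow> nat \<Rightarrow> nat \<Rightarrow> 3 cpoly" where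
  "p_shift j k1 k2 =
     (\<Sum>i\<le>j div 2. Const ((-1) ^ i * of_nat (j div 2 choose i)
                      * ffact (of_nat (k1 + j div 2)) i
                      * ffact (of_nat (k2 + j div 2)) (j div 2 - i))
                   * Indet 1 ^ (j div 2 - i) * Indet 2 ^ i)"

end

theory Submission
  imports Defs
begin

text \<open>
  Put \<open>v = (x, y)'\<close>, \<open>w\<^sup>s = r\<^sup>s v\<close> and \<open>Q\<^sub>s = r\<^sup>s[v]\<close>, and let \<open>u \<and> z = u\<^sub>1 z\<^sub>2 - u\<^sub>2 z\<^sub>1\<close> be the area form.
  Because the matrices are symmetric, \<open>(r\<^sup>s \<times> r\<^sup>t)[v] = 2 w\<^sup>s \<and> w\<^sup>t\<close>. With \<open>D\<^sub>s = k\<^sub>s + r\<^sub>s \<partial>\<^sub>s\<close> this gives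
  \<open>M\<^sub>k q = 2 (w\<^sup>1 \<and> w\<^sup>2 \<Psi>(D\<^sub>3 q) - w\<^sup>1 \<and> w\<^sup>3 \<Psi>(D\<^sub>2 q) + w\<^sup>2 \<and> w\<^sup>3 \<Psi>(D\<^sub>1 q))\<close>.

  Homogeneity is visible in this formula: replacing \<open>r\<^sup>s\<close> by \<open>G r\<^sup>s G'\<close> replaces \<open>Q\<^sub>s\<close> by \<open>r\<^sup>s[G' v]\<close> and
  \<open>w\<^sup>s\<close> by \<open>G (r\<^sup>s G' v)\<close>, and \<open>G u \<and> G z = det G (u \<and> z)\<close> (\<open>Mop_equivariant\<close>). The degree in \<open>x\<close> and \<open>y\<close> is 2
  from the area form and \<open>j\<close> from \<open>\<Psi>\<close>, as \<open>p\<close> is homogeneous of degree \<open>j/2\<close> (\<open>Mop_HR\<close>).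

  For harmonicity, substitute \<open>r\<^sup>s = \<xi>\<^sup>s (\<xi>\<^sup>s)'\<close>. In the variables of index \<open>s\<close>, the Laplacian of \<open>w\<^sup>s \<Psi>(q)\<close>
  is \<open>4 v \<Psi>(D\<^sub>s q) + 4 |v|\<^sup>2 w\<^sup>s \<Psi>(B\<^sub>s q)\<close> with \<open>|v|\<^sup>2 = x\<^sup>2 + y\<^sup>2\<close> and \<open>B\<^sub>s = r\<^sub>s \<partial>\<^sub>s\<^sup>2 + (k\<^sub>s + 1) \<partial>\<^sub>s\<close>
  (\<open>xi_lap_w_mult_lift_q\<close>). In \<open>\<Delta>(M\<^sub>k q)\<close> the terms with \<open>v \<and> w\<^sup>t\<close> cancel in pairs because the operators
  \<open>D\<^sub>s\<close> commute, and the identity \<open>(r\<^sub>s \<partial>\<^sub>s\<^sup>2 + k\<^sub>s \<partial>\<^sub>s) D\<^sub>s = D\<^sub>s B\<^sub>s\<close> brings the rest into the form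
  \<open>\<Delta>(M\<^sub>k q) = 4 |v|\<^sup>2 M\<^sub>k((B\<^sub>1 + B\<^sub>2 + B\<^sub>3) q)\<close> (\<open>xi_laplacian_Mop\<close>). It is therefore enough that \<open>p\<close> is
  annihilated by \<open>B\<^sub>1 + B\<^sub>2 + B\<^sub>3\<close>, which is a recursion between neighbouring coefficients
  (\<open>bessel_op_p_shift\<close>).
\<close>

section \<open>The polynomial ring: substitutions and derivations\<close>

lemma cpoly_monomial_induct [case_names monomial add]:
  fixes p :: "'x cpoly"
  assumes monomial: "\<And>m c. P (Poly_Mapping.single m c)"
    and add: "\<And>p q. P p \<Longrightarrow> P q \<Longrightarrow> P (p + q)"
  shows "P p"
proof -
  have "P (\<Sum>m\<in>A. Poly_Mapping.single m (Poly_Mapping.lookup p m))" if "finite A" for A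
    using that
  proof induction
    case empty
    show ?case using monomial[of 0 0] by simp
  qed (auto intro: monomial add)
  moreover have "(\<Sum>m\<in>Poly_Mapping.keys p. Poly_Mapping.single m (Poly_Mapping.lookup p m)) = p"
    by (rule poly_mapping_eqI)
      (auto simp: lookup_sum lookup_single when_def in_keys_iff sum.delta)
  ultimately show ?thesis by (metis finite_keys)
qed

lemma psubst_add [simp]: "psubst \<sigma> (p + q) = psubst \<sigma> p + psubst \<sigma> q"
  unfolding psubst_def
  by (rule setsum_keys_plus_distrib) (auto simp: Const_def single_add algebra_simps)

lemma psubst_single:
  "psubst \<sigma> (Poly_Mapping.single m c) =
     Const c * (\<Prod>a\<in>Poly_Mapping.keys m. \<sigma> a ^ Poly_Mapping.lookup m a)"
  by (simp add: psubst_def Const_def)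

lemma Const_mult: "Const (c * d) = Const c * Const d"
  by (simp add: Const_def mult_single)

lemma psubst_mult [simp]: "psubst \<sigma> (p * q) = psubst \<sigma> p * psubst \<sigma> q"
proof -
  let ?mon = "\<lambda>m. \<Prod>a\<in>Poly_Mapping.keys m. \<sigma> a ^ Poly_Mapping.lookup m a"
  have mon_eq: "?mon m = (\<Prod>a\<in>A. \<sigma> a ^ Poly_Mapping.lookup m a)"
    if "finite A" "Poly_Mapping.keys m \<subseteq> A" for m A
    using that by (intro prod.mono_neutral_left) (auto simp: in_keys_iff)
  have mon_add: "?mon (m + n) = ?mon m * ?mon n" for m n
  proof -
    let ?A = "Poly_Mapping.keys m \<union> Poly_Mapping.keys n"
    have "?mon (m + n) = (\<Prod>a\<in>?A. \<sigma> a ^ Poly_Mapping.lookup (m + n) a)"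
      by (rule mon_eq) (use keys_add[of m n] in auto)
    also have "\<dots> = (\<Prod>a\<in>?A. \<sigma> a ^ Poly_Mapping.lookup m a) * (\<Prod>a\<in>?A. \<sigma> a ^ Poly_Mapping.lookup n a)"
      by (simp add: lookup_add power_add prod.distrib)
    finally show ?thesis by (simp add: mon_eq[of ?A])
  qed
  show ?thesis
  proof (induction p rule: cpoly_monomial_induct)
    case (monomial m c)
    show ?case
    proof (induction q rule: cpoly_monomial_induct)
      case (monomial n d)
      show ?case by (simp add: mult_single psubst_single mon_add Const_mult mult_ac)
    qed (simp add: distrib_left)
  qed (simp add: distrib_right)
qed

lemma pdiff_add [simp]: "pdiff a (p + q) = pdiff a p + pdiff a q"
  unfolding pdiff_def
  by (rule setsum_keys_plus_distrib) (auto simp: distrib_left single_add)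

lemma pdiff_single:
  "pdiff a (Poly_Mapping.single m c) =
     Poly_Mapping.single (m - Poly_Mapping.single a 1) (of_nat (Poly_Mapping.lookup m a) * c)"
  by (simp add: pdiff_def)

text \<open>The Leibniz rule is checked on monomials. Exponents are subtracted with truncation, so moving
  the subtraction from one factor to the product is correct only if the exponent is positive; in the
  remaining case the coefficient in front vanishes.\<close>
lemma pdiff_mult [simp]: "pdiff a (p * q) = pdiff a p * q + p * pdiff a q"
proof (induction p rule: cpoly_monomial_induct)
  case (monomial m c)
  show ?case
  proof (induction q rule: cpoly_monomial_induct)
    case (monomial n d)
    let ?e = "Poly_Mapping.single a (1::nat)"
    let ?m = "Poly_Mapping.lookup m a" and ?n = "Poly_Mapping.lookup n a"
    have l: "Poly_Mapping.single (m + n - ?e) (of_nat ?m * c * d) =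
             Poly_Mapping.single (m - ?e + n) (of_nat ?m * c * d)"
    proof (cases "?m = 0")
      case False
      then have "m + n - ?e = m - ?e + n"
        by (intro poly_mapping_eqI) (auto simp: lookup_add lookup_minus lookup_single when_def)
      then show ?thesis by simp
    qed simp
    have r: "Poly_Mapping.single (m + n - ?e) (of_nat ?n * c * d) =
             Poly_Mapping.single (m + (n - ?e)) (of_nat ?n * c * d)"
    proof (cases "?n = 0")
      case False
      then have "m + n - ?e = m + (n - ?e)"
        by (intro poly_mapping_eqI) (auto simp: lookup_add lookup_minus lookup_single when_def)
      then show ?thesis by simp
    qed simp
    have "pdiff a (Poly_Mapping.single m c * Poly_Mapping.single n d) =
        Poly_Mapping.single (m + n - ?e) (of_nat ?m * c * d) +
        Poly_Mapping.single (m + n - ?e) (of_nat ?n * c * d)"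
      by (simp add: mult_single pdiff_single lookup_add single_add algebra_simps)
    then show ?case
      unfolding l r by (simp add: mult_single pdiff_single mult_ac add_ac)
  qed (simp add: algebra_simps)
qed (simp add: algebra_simps)

text \<open>A statement about all polynomials may be proved on the generators of the ring and propagated
  through sums and products. Once substitution is known to be multiplicative and differentiation to
  satisfy the Leibniz rule, this makes the composition of substitutions, the symmetry of second
  derivatives and the chain rule formal consequences.\<close>
lemma cpoly_ring_induct [case_names Const Indet add mult]:
  fixes p :: "'x cpoly"
  assumes Const: "\<And>c. P (Const c)" and Indet: "\<And>a. P (Indet a)"
    and add: "\<And>p q. P p \<Longrightarrow> P q \<Longrightarrow> P (p + q)"
    and mult: "\<And>p q. P p \<Longrightarrow> P q \<Longrightarrow> P (p * q)"
  shows "P p"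
proof (induction p rule: cpoly_monomial_induct)
  case (monomial m c)
  have power: "P (Poly_Mapping.single (Poly_Mapping.single a n) 1)" for a n
  proof (induction n)
    case 0
    then show ?case using Const[of 1] by (simp add: Const_def)
  next
    case (Suc n)
    have "Poly_Mapping.single (Poly_Mapping.single a (Suc n)) 1 =
        Indet a * Poly_Mapping.single (Poly_Mapping.single a n) 1"
      by (simp add: Indet_def mult_single flip: single_add)
    with Suc show ?case by (simp add: Indet mult)
  qed
  have "P (Poly_Mapping.single m 1)"
  proof (induction m rule: update_induct)
    case const
    then show ?case using Const[of 1] by (simp add: Const_def)
  next
    case (update m a n)
    have "Poly_Mapping.update a n m = Poly_Mapping.single a n + m"
      using update(1) by (intro poly_mapping_eqI)
        (auto simp: lookup_update lookup_add lookup_single when_def in_keys_iff)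
    then have "Poly_Mapping.single (Poly_Mapping.update a n m) (1::complex) =
        Poly_Mapping.single (Poly_Mapping.single a n) 1 * Poly_Mapping.single m 1"
      by (simp add: mult_single)
    with update show ?case by (simp add: power mult)
  qed
  moreover have "Poly_Mapping.single m c = Const c * Poly_Mapping.single m 1"
    by (simp add: Const_def mult_single)
  ultimately show ?case by (simp add: Const mult)
qed (rule add)

lemma Const_simps [simp]:
  "Const 0 = 0" "Const 1 = 1" "Const (of_nat n) = of_nat n"
  by (simp_all add: Const_def)

lemma Const_add: "Const (c + d) = Const c + Const d"
  by (simp add: Const_def single_add)

lemma Const_diff: "Const (c - d) = Const c - Const d"
  by (simp add: Const_def single_diff)

lemma psubst_Const [simp]: "psubst \<sigma> (Const c) = Const c"
  using psubst_single[of \<sigma> 0 c] by (simp flip: Const_def)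

lemma psubst_Indet [simp]: "psubst \<sigma> (Indet a) = \<sigma> a"
  by (simp add: Indet_def psubst_single)

lemma pdiff_Const [simp]: "pdiff a (Const c) = 0"
  by (simp add: Const_def pdiff_single)

lemma pdiff_Indet [simp]: "pdiff a (Indet b) = (if a = b then 1 else 0)"
  by (simp add: Indet_def pdiff_single lookup_single)

lemma psubst_simps [simp]:
  "psubst \<sigma> 0 = 0" "psubst \<sigma> 1 = 1" "psubst \<sigma> (of_nat n) = of_nat n"
  using psubst_Const[of \<sigma> 0] psubst_Const[of \<sigma> 1] psubst_Const[of \<sigma> "of_nat n"] by simp_all

lemma psubst_uminus [simp]: "psubst \<sigma> (- p) = - psubst \<sigma> p"
  by (rule minus_unique[symmetric]) (simp flip: psubst_add)

lemma psubst_diff [simp]: "psubst \<sigma> (p - q) = psubst \<sigma> p - psubst \<sigma> q"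
  using psubst_add[of \<sigma> p "- q"] by simp

lemma psubst_sum [simp]: "psubst \<sigma> (sum f A) = (\<Sum>a\<in>A. psubst \<sigma> (f a))"
  by (induction A rule: infinite_finite_induct) simp_all

lemma pdiff_simps [simp]:
  "pdiff a 0 = 0" "pdiff a 1 = 0" "pdiff a (of_nat n) = 0"
  using pdiff_Const[of a 0] pdiff_Const[of a 1] pdiff_Const[of a "of_nat n"] by simp_all

lemma pdiff_uminus [simp]: "pdiff a (- p) = - pdiff a p"
  by (rule minus_unique[symmetric]) (simp flip: pdiff_add)

lemma pdiff_diff [simp]: "pdiff a (p - q) = pdiff a p - pdiff a q"
  using pdiff_add[of a p "- q"] by simp

lemma pdiff_sum [simp]: "pdiff a (sum f A) = (\<Sum>x\<in>A. pdiff a (f x))"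
  by (induction A rule: infinite_finite_induct) simp_all

lemma pdiff_numeral [simp]: "pdiff a (numeral n) = 0"
  using pdiff_simps(3)[of a "numeral n"] by simp

lemma pdiff_power: "pdiff a (p ^ n) = of_nat n * p ^ (n - 1) * pdiff a p"
proof (induction n)
  case (Suc n)
  then show ?case by (cases n) (simp_all add: algebra_simps)
qed simp

lemma pdiff_commute: "pdiff a (pdiff b p) = pdiff b (pdiff a p)"
  by (induction p rule: cpoly_ring_induct) (simp_all add: algebra_simps)

lemma psubst_psubst: "psubst \<tau> (psubst \<sigma> p) = psubst (\<lambda>a. psubst \<tau> (\<sigma> a)) p"
  by (induction p rule: cpoly_ring_induct) simp_all

lemma pdiff_psubst:
  fixes \<sigma> :: "'x::finite \<Rightarrow> 'y cpoly"
  shows "pdiff a (psubst \<sigma> p) = (\<Sum>s\<in>UNIV. psubst \<sigma> (pdiff s p) * pdiff a (\<sigma> s))"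
proof (induction p rule: cpoly_ring_induct)
  case (Indet b)
  have "(\<Sum>s\<in>UNIV. psubst \<sigma> (pdiff s (Indet b)) * pdiff a (\<sigma> s)) =
      (\<Sum>s\<in>UNIV. if s = b then pdiff a (\<sigma> s) else 0)"
    by (intro sum.cong) auto
  then show ?case by simp
qed (simp_all add: distrib_right distrib_left sum.distrib sum_distrib_left sum_distrib_right mult_ac)

section \<open>Euler and Bessel operators\<close>

text \<open>With \<open>D\<^sub>s = k\<^sub>s + r\<^sub>s \<partial>\<^sub>s\<close>, the operator \<open>M\<^sub>k\<close> applies one \<open>D\<^sub>s\<close> in each of its terms.\<close>
definition euler_op :: "nat ^ 'x \<Rightarrow> 'x::finite \<Rightarrow> 'x cpoly \<Rightarrow> 'x cpoly" where
  "euler_op k s q = of_nat (k $ s) * q + Indet s * pdiff s q"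

text \<open>The operator \<open>B\<^sub>s = r\<^sub>s \<partial>\<^sub>s\<^sup>2 + (k\<^sub>s + 1) \<partial>\<^sub>s\<close>. Without the shift, \<open>r\<^sub>s \<partial>\<^sub>s\<^sup>2 + k\<^sub>s \<partial>\<^sub>s\<close> is a quarter of
  the Laplacian of \<open>\<complex>\<^bsup>2k\<^sub>s\<^esup>\<close> on functions of the squared length \<open>r\<^sub>s\<close>; the parameter is raised by
  one when such a function is multiplied by a linear coordinate. That is the origin of the index
  \<open>(k\<^sub>1 + 1, k\<^sub>2 + 1)\<close> of \<open>p\<close>.\<close>
definition bessel_op :: "nat ^ 'x \<Rightarrow> 'x::finite \<Rightarrow> 'x cpoly \<Rightarrow> 'x cpoly" where
  "bessel_op k s q = Indet s * pdiff s (pdiff s q) + of_nat (k $ s + 1) * pdiff s q"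

lemma euler_op_commute: "euler_op k s (euler_op k t q) = euler_op k t (euler_op k s q)"
proof (cases "s = t")
  case False
  then show ?thesis
    by (simp add: euler_op_def algebra_simps pdiff_commute[of t s])
qed simp

lemma bessel_op_euler_op:
  assumes "s \<noteq> t"
  shows "bessel_op k s (euler_op k t q) = euler_op k t (bessel_op k s q)"
  using assms
  by (simp add: euler_op_def bessel_op_def algebra_simps pdiff_commute[of t s])

text \<open>Since \<open>r\<^sub>s \<partial>\<^sub>s\<^sup>2 + k\<^sub>s \<partial>\<^sub>s = D\<^sub>s \<partial>\<^sub>s\<close> and \<open>\<partial>\<^sub>s D\<^sub>s = B\<^sub>s\<close>, both sides are \<open>D\<^sub>s \<partial>\<^sub>s D\<^sub>s\<close>. In a term
  \<open>w\<^sup>s \<and> w\<^sup>t \<Psi>(D\<^sub>u q)\<close> of \<open>M\<^sub>k q\<close>, the index \<open>u\<close> has no linear factor to raise its parameter; here \<open>D\<^sub>u\<close> does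
  it instead, so that all three indices contribute operators of the same kind.\<close>
lemma laplace_euler_op:
  "Indet s * pdiff s (pdiff s (euler_op k s q)) + of_nat (k $ s) * pdiff s (euler_op k s q) =
     euler_op k s (bessel_op k s q)"
  by (simp add: euler_op_def bessel_op_def algebra_simps)

lemma euler_op_add: "euler_op k s (p + q) = euler_op k s p + euler_op k s q"
  by (simp add: euler_op_def algebra_simps)

lemma bessel_op_sum: "bessel_op k s (sum f A) = (\<Sum>a\<in>A. bessel_op k s (f a))"
  by (simp add: bessel_op_def sum_distrib_left sum.distrib)

lemma bessel_op_mult_const:
  assumes "pdiff s p = 0"
  shows "bessel_op k s (p * q) = p * bessel_op k s q"
  using assms by (simp add: bessel_op_def algebra_simps)

lemma bessel_op_power:
  "bessel_op k s (Indet s ^ n) = of_nat (n * (n + k $ s)) * Indet s ^ (n - 1)"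
proof -
  have pow: "pdiff s (Indet s ^ m) = of_nat m * Indet s ^ (m - 1)" for m
    by (simp add: pdiff_power)
  consider "n = 0" | "n = 1" | m where "n = Suc (Suc m)"
    by (cases n rule: nat.exhaust) (auto, metis One_nat_def not0_implies_Suc)
  then show ?thesis
  proof cases
    case (3 m)
    have "bessel_op k s (Indet s ^ n) =
        of_nat n * of_nat (Suc m) * (Indet s * Indet s ^ m)
        + of_nat (k $ s + 1) * of_nat n * Indet s ^ Suc m"
      unfolding bessel_op_def pow pdiff_mult 3 by (simp add: pow mult_ac del: power_Suc)
    then show ?thesis by (simp add: 3 algebra_simps)
  qed (simp_all add: bessel_op_def algebra_simps)
qed

section \<open>Equivariance\<close>

definition wedge :: "'a::comm_ring_1 ^ 2 \<Rightarrow> 'a ^ 2 \<Rightarrow> 'a" where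
  "wedge u z = u $ 1 * z $ 2 - u $ 2 * z $ 1"

lemma wedge_swap: "wedge u z = - wedge z u"
  by (simp add: wedge_def algebra_simps)

lemma wedge_matrix: "wedge (M *v u) (M *v z) = det M * wedge u z"
  by (simp add: wedge_def matrix_vector_mult_def det_2 sum_2 algebra_simps)

text \<open>As \<open>J\<close> is skew and \<open>A\<close>, \<open>B\<close> are symmetric, the two summands of \<open>(A \<times> B)[w]\<close> agree, and both
  equal the area form on the vectors \<open>A w\<close> and \<open>B w\<close>. In this shape the factor \<open>det G\<close> and the Laplacian are easy to compute.\<close>
lemma qform_mcross:
  assumes "A $ 2 $ 1 = A $ 1 $ 2" and "B $ 2 $ 1 = B $ 1 $ 2"
  shows "qform (mcross A B) w = 2 * wedge (A *v w) (B *v w)"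
  using assms
  by (simp add: qform_def mcross_def Jmat_def wedge_def matrix_vector_mult_def
      matrix_matrix_mult_def sum_2 algebra_simps)

text \<open>The value of \<open>M\<^sub>k q\<close> at symmetric matrices \<open>A s\<close> and a vector \<open>w\<close> over any polynomial ring. Both
  the action of \<open>GL(2,\<complex>)\<close> and the passage to the variables \<open>\<xi>\<^sup>s\<close> are evaluations of this kind.\<close>
definition Mform ::
  "(3 \<Rightarrow> 'y cpoly ^ 2 ^ 2) \<Rightarrow> 'y cpoly ^ 2 \<Rightarrow> nat ^ 3 \<Rightarrow> 3 cpoly \<Rightarrow> 'y cpoly" where
  "Mform A w k q =
     (let C = (\<lambda>s t. 2 * wedge (A s *v w) (A t *v w));
          E = (\<lambda>s. psubst (\<lambda>t. qform (A t) w) (euler_op k s q))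
      in C 1 2 * E 3 - C 1 3 * E 2 + C 2 3 * E 1)"

lemma subst_rv_Mop:
  assumes "\<And>s. A s $ 2 $ 1 = A s $ 1 $ 2"
  shows "subst_rv A w (Mop k q) = Mform A w k q"
proof -
  have hom: "subst_rv A w (p + q) = subst_rv A w p + subst_rv A w q"
      "subst_rv A w (p - q) = subst_rv A w p - subst_rv A w q"
      "subst_rv A w (p * q) = subst_rv A w p * subst_rv A w q" for p q
    by (simp_all add: subst_rv_def)
  have quad: "subst_rv A w (qform (rmat s) vvec) = qform (A s) w" for s
    by (simp add: qform_def matrix_vector_mult_def sum_2 rmat_def vvec_def subst_rv_def assms)
  have cross: "subst_rv A w (qform (mcross (rmat s) (rmat t)) vvec) =
      2 * wedge (A s *v w) (A t *v w)" for s t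
  proof -
    have "psubst \<sigma> 2 = 2" for \<sigma> :: "3 rvar \<Rightarrow> 'a cpoly"
      using psubst_simps(3)[of \<sigma> 2] by simp
    then show ?thesis
      by (subst qform_mcross)
        (simp_all add: wedge_def matrix_vector_mult_def sum_2 rmat_def vvec_def subst_rv_def assms)
  qed
  have Psi: "subst_rv A w (Psi p) = psubst (\<lambda>t. qform (A t) w) p" for p
    using quad by (simp add: Psi_def subst_rv_def psubst_psubst)
  show ?thesis
    by (simp add: Mop_def Let_def hom cross Psi Mform_def flip: euler_op_def)
qed

text \<open>Quadratic forms only see \<open>transpose M *v w\<close>, while each area form acquires exactly one factor
  \<open>det M\<close>; this accounts for the weight \<open>det\<^sup>1\<close>.\<close>
lemma Mform_equivariant:
  "Mform (\<lambda>s. M ** A s ** transpose M) w k q = det M * Mform A (transpose M *v w) k q"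
proof -
  have "qform (M ** A s ** transpose M) w = qform (A s) (transpose M *v w)" for s
    by (simp add: qform_def matrix_vector_mult_def matrix_matrix_mult_def transpose_def sum_2
        algebra_simps)
  moreover have "(M ** A s ** transpose M) *v w = M *v (A s *v (transpose M *v w))" for s
    by (simp add: matrix_vector_mul_assoc matrix_mul_assoc del: transpose_matrix_vector)
  ultimately show ?thesis
    by (simp add: Mform_def Let_def wedge_matrix algebra_simps del: transpose_matrix_vector)
qed

lemma Mop_equivariant:
  "subst_rv (\<lambda>s. Const_mat G ** rmat s ** transpose (Const_mat G)) vvec (Mop k q) =
     Const (det G) * subst_rv rmat (transpose (Const_mat G) *v vvec) (Mop k q)"
proof -
  have "det (Const_mat G :: 3 rvar cpoly ^ 2 ^ 2) = Const (det G)"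
    by (simp add: det_2 Const_mat_def Const_diff Const_mult)
  moreover have "(Const_mat G ** rmat s ** transpose (Const_mat G)) $ 2 $ 1 =
      (Const_mat G ** rmat s ** transpose (Const_mat G)) $ 1 $ 2" for s :: 3
    by (simp add: matrix_matrix_mult_def transpose_def sum_2 rmat_def algebra_simps)
  moreover have "rmat s $ 2 $ 1 = rmat s $ 1 $ 2" for s :: 3
    by (simp add: rmat_def)
  ultimately show ?thesis by (simp add: subst_rv_Mop Mform_equivariant del: transpose_matrix_vector)
qed

section \<open>Degree in \<open>x\<close> and \<open>y\<close>\<close>

lemma HR_add: "P \<in> HR j \<Longrightarrow> Q \<in> HR j \<Longrightarrow> P + Q \<in> HR j"
  using keys_add[of P Q] by (auto simp: HR_def)

lemma HR_zero: "0 \<in> HR j"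
  by (simp add: HR_def)

lemma HR_uminus: "P \<in> HR j \<Longrightarrow> - P \<in> HR j"
  by (simp add: HR_def)

lemma HR_diff: "P \<in> HR j \<Longrightarrow> Q \<in> HR j \<Longrightarrow> P - Q \<in> HR j"
  using HR_add[of P j "- Q"] HR_uminus[of Q j] by simp

lemma HR_sum: "(\<And>a. a \<in> A \<Longrightarrow> f a \<in> HR j) \<Longrightarrow> sum f A \<in> HR j"
  by (induction A rule: infinite_finite_induct) (auto intro: HR_add HR_zero)

lemma HR_mult: "P \<in> HR i \<Longrightarrow> Q \<in> HR j \<Longrightarrow> P * Q \<in> HR (i + j)"
  using keys_mult[of P Q] by (fastforce simp: HR_def lookup_add)

lemma HR_Const: "Const c \<in> HR 0"
  by (simp add: HR_def Const_def)

lemma HR_one: "1 \<in> HR 0"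
  using HR_Const[of 1] by simp

lemma HR_Indet:
  "Indet VarX \<in> HR 1" "Indet VarY \<in> HR 1"
  "Indet (R11 s) \<in> HR 0" "Indet (R12 s) \<in> HR 0" "Indet (R22 s) \<in> HR 0"
  by (simp_all add: HR_def Indet_def lookup_single)

lemma HR_power: "P \<in> HR i \<Longrightarrow> P ^ n \<in> HR (n * i)"
  by (induction n) (auto intro: HR_mult HR_one)

lemma HR_prod: "(\<And>a. a \<in> A \<Longrightarrow> f a \<in> HR (d a)) \<Longrightarrow> prod f A \<in> HR (sum d A)"
  by (induction A rule: infinite_finite_induct) (auto intro: HR_mult HR_one)

lemma qform_HR:
  assumes "\<And>a b. A $ a $ b \<in> HR 0"
  shows "qform A vvec \<in> HR 2"
proof -
  have v: "vvec $ a \<in> HR 1" for a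
    using exhaust_2[of a] HR_Indet by (auto simp: vvec_def)
  have "vvec $ a * (\<Sum>b\<in>UNIV. A $ a $ b * vvec $ b) \<in> HR (1 + (0 + 1))" for a
    by (intro HR_mult HR_sum v assms)
  then show ?thesis
    by (auto simp: qform_def matrix_vector_mult_def numeral_2_eq_2 intro!: HR_sum)
qed

lemma rmat_HR: "rmat s $ a $ b \<in> HR 0"
  using exhaust_2[of a] exhaust_2[of b] by (auto simp: rmat_def HR_Indet)

lemma mcross_rmat_HR: "mcross (rmat s) (rmat t) $ a $ b \<in> HR 0"
proof -
  have [simp]: "P * Q \<in> HR 0" if "P \<in> HR 0" "Q \<in> HR 0" for P Q :: "'a rvar cpoly"
    using HR_mult[OF that] by simp
  show ?thesis
    using exhaust_2[of a] exhaust_2[of b]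
    by (auto simp: mcross_def matrix_matrix_mult_def sum_2 Jmat_def rmat_HR
        intro!: HR_add HR_diff HR_uminus)
qed

definition total_degree :: "('x::finite \<Rightarrow>\<^sub>0 nat) \<Rightarrow> nat" where
  "total_degree m = (\<Sum>a\<in>UNIV. Poly_Mapping.lookup m a)"

lemma Psi_HR:
  assumes "\<And>m. m \<in> Poly_Mapping.keys q \<Longrightarrow> total_degree m = n"
  shows "Psi q \<in> HR (2 * n)"
proof -
  have "Const (Poly_Mapping.lookup q m) *
      (\<Prod>a\<in>Poly_Mapping.keys m. qform (rmat a) vvec ^ Poly_Mapping.lookup m a)
      \<in> HR (0 + (\<Sum>a\<in>Poly_Mapping.keys m. Poly_Mapping.lookup m a * 2))" for m
    by (intro HR_mult HR_prod HR_power HR_Const qform_HR rmat_HR)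
  moreover have "(\<Sum>a\<in>Poly_Mapping.keys m. Poly_Mapping.lookup m a * 2) = 2 * total_degree m"
    for m :: "3 \<Rightarrow>\<^sub>0 nat"
    unfolding total_degree_def sum_distrib_left
    by (rule sum.mono_neutral_cong_left) (auto simp: in_keys_iff)
  ultimately show ?thesis
    using assms by (auto simp: Psi_def psubst_def intro!: HR_sum)
qed

text \<open>Monomials are eigenvectors of \<open>D\<^sub>s\<close>, which therefore preserves homogeneity and the degree.\<close>
lemma keys_euler_op: "Poly_Mapping.keys (euler_op k s q) \<subseteq> Poly_Mapping.keys q"
proof -
  have "Indet s * Poly_Mapping.single (m - Poly_Mapping.single s 1)
      (of_nat (Poly_Mapping.lookup m s) * c) = Poly_Mapping.single m (of_nat (Poly_Mapping.lookup m s) * c)"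
    for m and c :: complex
  proof (cases "Poly_Mapping.lookup m s = 0")
    case False
    then have "Poly_Mapping.single s 1 + (m - Poly_Mapping.single s 1) = m"
      by (intro poly_mapping_eqI) (auto simp: lookup_add lookup_minus lookup_single when_def)
    then show ?thesis by (simp add: Indet_def mult_single)
  qed simp
  then have "Indet s * pdiff s q = (\<Sum>m\<in>Poly_Mapping.keys q.
      Poly_Mapping.single m (of_nat (Poly_Mapping.lookup m s) * Poly_Mapping.lookup q m))"
    by (simp add: pdiff_def sum_distrib_left)
  also have "Poly_Mapping.keys \<dots> \<subseteq> Poly_Mapping.keys q"
    by (rule order_trans[OF keys_sum]) (auto split: if_splits)
  finally have "Poly_Mapping.keys (Indet s * pdiff s q) \<subseteq> Poly_Mapping.keys q" .
  moreover have "Poly_Mapping.keys (of_nat (k $ s) * q) \<subseteq> Poly_Mapping.keys q"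
    using keys_mult[of "Const (of_nat (k $ s))" q]
    unfolding Const_simps(3)[symmetric] by (auto simp: Const_def simp del: single_of_nat split: if_splits)
  ultimately show ?thesis
    using keys_add[of "of_nat (k $ s) * q" "Indet s * pdiff s q"] by (auto simp: euler_op_def)
qed

lemma Mop_HR:
  assumes "\<And>m. m \<in> Poly_Mapping.keys q \<Longrightarrow> total_degree m = n"
  shows "Mop k q \<in> HR (2 * n + 2)"
proof -
  have "Psi (euler_op k s q) \<in> HR (2 * n)" for s
    using keys_euler_op[of k s q] assms by (intro Psi_HR) auto
  then have "qform (mcross (rmat s) (rmat t)) vvec * Psi (euler_op k u q) \<in> HR (2 + 2 * n)" for s t u
    by (intro HR_mult qform_HR mcross_rmat_HR)
  then have "Mop k q \<in> HR (2 + 2 * n)"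
    by (simp only: Mop_def Let_def HR_add HR_diff flip: euler_op_def)
  then show ?thesis by (simp only: add.commute)
qed

lemma keys_p_shift:
  assumes "m \<in> Poly_Mapping.keys (p_shift j k1 k2)"
  shows "total_degree m = j div 2"
proof -
  let ?S = "\<lambda>n. {q :: 3 cpoly. \<forall>m\<in>Poly_Mapping.keys q. total_degree m = n}"
  have mult: "p * q \<in> ?S (a + b)" if "p \<in> ?S a" "q \<in> ?S b" for p q a b
    using that keys_mult[of p q] by (fastforce simp: total_degree_def lookup_add sum.distrib)
  have C: "Const c \<in> ?S 0" for c
    by (simp add: Const_def total_degree_def)
  have "Indet s \<in> ?S 1" for s
    by (simp add: Indet_def total_degree_def lookup_single when_def)
  then have pow: "Indet s ^ n \<in> ?S n" for s n
  proof (induction n)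
    case 0
    show ?case using C[of 1] by simp
  next
    case (Suc n)
    then show ?case using mult[of "Indet s" 1 "Indet s ^ n" n] by simp
  qed
  have "Const c * Indet 1 ^ (j div 2 - i) * Indet 2 ^ i \<in> ?S (j div 2)" if "i \<le> j div 2" for c i
    using mult[OF mult[OF C pow] pow, of c 1 "j div 2 - i" 2 i] that by simp
  moreover from assms obtain i where "i \<le> j div 2"
    "m \<in> Poly_Mapping.keys (Const ((-1) ^ i * of_nat (j div 2 choose i)
        * ffact (of_nat (k1 + j div 2)) i * ffact (of_nat (k2 + j div 2)) (j div 2 - i))
      * Indet 1 ^ (j div 2 - i) * Indet 2 ^ i :: 3 cpoly)"
    unfolding p_shift_def using keys_sum by fastforce
  ultimately show ?thesis by blast
qed

section \<open>The Laplacian on the variables \<open>\<xi>\<^sup>s\<close>\<close>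

abbreviation xi_vec :: "'t xivar cpoly ^ 2" where
  "xi_vec \<equiv> vector [Indet XiX, Indet XiY]"

text \<open>The entry \<open>u\<^sup>s\<^sub>j\<close> of \<open>u\<^sup>s = (\<xi>\<^sup>s)' v\<close>. The Gram matrix \<open>\<xi>\<^sup>s (\<xi>\<^sup>s)'\<close> enters the computation only through
  \<open>w\<^sup>s = \<xi>\<^sup>s u\<^sup>s\<close> and \<open>Q\<^sub>s = (u\<^sup>s)' u\<^sup>s\<close>, which are \<open>xi_w\<close> and \<open>xi_q\<close> below.\<close>
definition xi_col :: "'t \<Rightarrow> nat \<Rightarrow> 't xivar cpoly" where
  "xi_col s j = (\<Sum>a\<in>UNIV. xi_vec $ a * Indet (Xi s a j))"

definition xi_norm :: "'t xivar cpoly" where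
  "xi_norm = (\<Sum>a\<in>UNIV. (xi_vec $ a)\<^sup>2)"

definition xi_w :: "nat ^ 't \<Rightarrow> 't \<Rightarrow> 't xivar cpoly ^ 2" where
  "xi_w k s = xi_gram k s *v xi_vec"

definition xi_q :: "nat ^ 't \<Rightarrow> 't \<Rightarrow> 't xivar cpoly" where
  "xi_q k s = qform (xi_gram k s) xi_vec"

lemma xi_w_eq: "xi_w k s $ a = (\<Sum>j = 1..2 * k $ s. Indet (Xi s a j) * xi_col s j)"
  by (simp add: xi_w_def xi_gram_def matrix_vector_mult_def xi_col_def sum_2 sum_distrib_left
      sum_distrib_right algebra_simps sum.distrib)

lemma xi_q_eq: "xi_q k s = (\<Sum>j = 1..2 * k $ s. (xi_col s j)\<^sup>2)"
  by (simp add: xi_q_def xi_gram_def qform_def matrix_vector_mult_def xi_col_def sum_2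
      sum_distrib_left sum_distrib_right algebra_simps sum.distrib power2_eq_square)

lemma pdiff_xi_vec [simp]: "pdiff (Xi s i j) (xi_vec $ a) = 0"
  using exhaust_2[of a] by auto

lemma pdiff_xi_col [simp]:
  "pdiff (Xi s i j) (xi_col t l) = (if s = t \<and> j = l then xi_vec $ i else 0)"
  using exhaust_2[of i] by (auto simp: xi_col_def sum_2)

lemma sum_if_and_delta:
  assumes "finite A"
  shows "(\<Sum>l\<in>A. if P \<and> j = l then f l else 0) = (if P \<and> j \<in> A then f j else 0)"
  using assms by (cases P) (auto simp: sum.delta')

lemma pdiff_xi_w:
  assumes "j \<in> {1..2 * k $ s}"
  shows "pdiff (Xi s i j) (xi_w k t $ a) =
    (if s = t then (if i = a then xi_col s j else 0) + Indet (Xi s a j) * xi_vec $ i else 0)"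
proof -
  have "pdiff (Xi s i j) (xi_w k t $ a) =
      (\<Sum>l = 1..2 * k $ t. if s = t \<and> j = l then
        (if i = a then xi_col s l else 0) + Indet (Xi s a l) * xi_vec $ i else 0)"
    unfolding xi_w_eq pdiff_sum by (intro sum.cong) auto
  then show ?thesis using assms by (auto simp: sum_if_and_delta)
qed

lemma pdiff_xi_q:
  assumes "j \<in> {1..2 * k $ s}"
  shows "pdiff (Xi s i j) (xi_q k t) = (if s = t then 2 * (xi_vec $ i * xi_col s j) else 0)"
proof -
  have "pdiff (Xi s i j) (xi_q k t) =
      (\<Sum>l = 1..2 * k $ t. if s = t \<and> j = l then 2 * (xi_vec $ i * xi_col s l) else 0)"
    unfolding xi_q_eq pdiff_sum by (intro sum.cong) (auto simp: power2_eq_square algebra_simps)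
  then show ?thesis using assms by (auto simp: sum_if_and_delta)
qed

text \<open>The polynomial \<open>\<Psi>(q)\<close> in the variables \<open>\<xi>\<^sup>s\<close>.\<close>
abbreviation lift_q :: "nat ^ 't \<Rightarrow> 't cpoly \<Rightarrow> 't xivar cpoly" where
  "lift_q k \<equiv> psubst (xi_q k)"

lemma pdiff_lift_q:
  assumes "j \<in> {1..2 * k $ s}"
  shows "pdiff (Xi s i j) (lift_q k q) = 2 * (xi_vec $ i * xi_col s j) * lift_q k (pdiff s q)"
proof -
  have "pdiff (Xi s i j) (lift_q k q) =
     (\<Sum>t\<in>UNIV. if s = t then 2 * (xi_vec $ i * xi_col s j) * lift_q k (pdiff t q) else 0)"
    unfolding pdiff_psubst using assms by (intro sum.cong) (auto simp: pdiff_xi_q)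
  then show ?thesis by simp
qed

definition xi_lap :: "nat ^ 't \<Rightarrow> 't \<Rightarrow> 't xivar cpoly \<Rightarrow> 't xivar cpoly" where
  "xi_lap k s P = (\<Sum>i\<in>UNIV. \<Sum>j = 1..2 * k $ s. pdiff (Xi s i j) (pdiff (Xi s i j) P))"

text \<open>The pairing of gradients, which measures the failure of the Laplacian to be a derivation.\<close>
definition xi_grad :: "nat ^ 't \<Rightarrow> 't \<Rightarrow> 't xivar cpoly \<Rightarrow> 't xivar cpoly \<Rightarrow> 't xivar cpoly" where
  "xi_grad k s P Q = (\<Sum>i\<in>UNIV. \<Sum>j = 1..2 * k $ s. pdiff (Xi s i j) P * pdiff (Xi s i j) Q)"

lemma xi_laplacian_eq: "xi_laplacian k P = (\<Sum>s\<in>UNIV. xi_lap k s P)"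
  by (simp add: xi_laplacian_def xi_lap_def)

lemma xi_lap_add: "xi_lap k s (P + Q) = xi_lap k s P + xi_lap k s Q"
  by (simp add: xi_lap_def sum.distrib)

lemma xi_lap_diff: "xi_lap k s (P - Q) = xi_lap k s P - xi_lap k s Q"
  by (simp add: xi_lap_def sum_subtractf)

lemma xi_lap_uminus: "xi_lap k s (- P) = - xi_lap k s P"
  by (simp add: xi_lap_def sum_negf)

lemma xi_laplacian_simps:
  "xi_laplacian k (P + Q) = xi_laplacian k P + xi_laplacian k Q"
  "xi_laplacian k (P - Q) = xi_laplacian k P - xi_laplacian k Q"
  by (simp_all add: xi_laplacian_eq xi_lap_add xi_lap_diff sum.distrib sum_subtractf)

lemma xi_lap_mult:
  "xi_lap k s (P * Q) = xi_lap k s P * Q + 2 * xi_grad k s P Q + P * xi_lap k s Q"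
  by (simp add: xi_lap_def xi_grad_def sum_distrib_left sum_distrib_right algebra_simps
      flip: sum.distrib)

lemma xi_lap_mult_const:
  assumes "\<And>i j. j \<in> {1..2 * k $ s} \<Longrightarrow> pdiff (Xi s i j) P = 0"
  shows "xi_lap k s (P * Q) = P * xi_lap k s Q"
  using assms by (simp add: xi_lap_def sum_distrib_left)

text \<open>The gradient of \<open>Q\<^sub>s\<close> is \<open>2 v\<^sub>i u\<^sup>s\<^sub>j\<close>, of squared length \<open>4 |v|\<^sup>2 Q\<^sub>s\<close>, and its Laplacian is
  \<open>2 (2 k\<^sub>s) |v|\<^sup>2\<close>. The result is the radial Laplacian in \<open>2 k\<^sub>s\<close> variables, scaled by \<open>|v|\<^sup>2\<close>.\<close>
lemma xi_lap_lift_q: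
  "xi_lap k s (lift_q k q) =
     4 * xi_norm * lift_q k (Indet s * pdiff s (pdiff s q) + of_nat (k $ s) * pdiff s q)"
proof -
  let ?d = "lift_q k (pdiff s q)" and ?dd = "lift_q k (pdiff s (pdiff s q))"
  have "pdiff (Xi s i j) (pdiff (Xi s i j) (lift_q k q)) =
      4 * (xi_vec $ i)\<^sup>2 * (xi_col s j)\<^sup>2 * ?dd + 2 * (xi_vec $ i)\<^sup>2 * ?d"
    if "j \<in> {1..2 * k $ s}" for i j
    using that by (simp add: pdiff_lift_q power2_eq_square algebra_simps)
  then have "xi_lap k s (lift_q k q) =
      (\<Sum>i\<in>UNIV. \<Sum>j = 1..2 * k $ s.
        4 * (xi_vec $ i)\<^sup>2 * (xi_col s j)\<^sup>2 * ?dd + 2 * (xi_vec $ i)\<^sup>2 * ?d)"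
    unfolding xi_lap_def by (intro sum.cong) auto
  also have "\<dots> = 4 * xi_norm * (xi_q k s * ?dd + of_nat (k $ s) * ?d)"
    by (simp add: sum.distrib xi_norm_def xi_q_eq sum_2 sum_distrib_left sum_distrib_right
        algebra_simps)
  finally show ?thesis by simp
qed

text \<open>Besides the previous contribution there are \<open>\<Delta> w\<^sub>a = 4 k\<^sub>s v\<^sub>a\<close> and the pairing of the gradients of
  \<open>w\<^sub>a\<close> and \<open>Q\<^sub>s\<close>, which is \<open>2 (v\<^sub>a Q\<^sub>s + |v|\<^sup>2 w\<^sub>a)\<close>. The parts with \<open>v\<^sub>a\<close> combine to \<open>D\<^sub>s\<close>, those with \<open>w\<^sub>a\<close>
  to \<open>B\<^sub>s\<close>.\<close>
lemma xi_lap_w_mult_lift_q: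
  "xi_lap k s (xi_w k s $ a * lift_q k q) =
     4 * xi_vec $ a * lift_q k (euler_op k s q) + 4 * xi_norm * xi_w k s $ a * lift_q k (bessel_op k s q)"
proof -
  let ?d = "lift_q k (pdiff s q)"
  have "pdiff (Xi s i j) (pdiff (Xi s i j) (xi_w k s $ a)) = (if i = a then 2 * xi_vec $ a else 0)"
    if "j \<in> {1..2 * k $ s}" for i j
    using that by (auto simp: pdiff_xi_w)
  then have "xi_lap k s (xi_w k s $ a) =
      (\<Sum>i\<in>UNIV. \<Sum>j = 1..2 * k $ s. if i = a then 2 * xi_vec $ a else 0)"
    unfolding xi_lap_def by (intro sum.cong) auto
  also have "\<dots> = of_nat (4 * k $ s) * xi_vec $ a"
    using exhaust_2[of a] by (auto simp: sum_2)
  finally have lap: "xi_lap k s (xi_w k s $ a) = of_nat (4 * k $ s) * xi_vec $ a" .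
  have "xi_grad k s (xi_w k s $ a) (lift_q k q) = (\<Sum>i\<in>UNIV. \<Sum>j = 1..2 * k $ s.
      2 * ((if i = a then xi_vec $ a * (xi_col s j)\<^sup>2 else 0)
        + (xi_vec $ i)\<^sup>2 * (Indet (Xi s a j) * xi_col s j)) * ?d)"
    unfolding xi_grad_def
    by (intro sum.cong) (auto simp: pdiff_xi_w pdiff_lift_q power2_eq_square algebra_simps)
  also have "\<dots> = 2 * (xi_vec $ a * xi_q k s + xi_norm * xi_w k s $ a) * ?d"
    using exhaust_2[of a]
    by (auto simp: sum.distrib xi_norm_def xi_q_eq xi_w_eq sum_2 sum_distrib_left
        sum_distrib_right algebra_simps)
  finally have grad: "xi_grad k s (xi_w k s $ a) (lift_q k q) =
      2 * (xi_vec $ a * xi_q k s + xi_norm * xi_w k s $ a) * ?d" .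
  show ?thesis
    unfolding xi_lap_mult lap grad xi_lap_lift_q
    by (simp add: euler_op_def bessel_op_def algebra_simps)
qed

lemma xi_lap_wedge_left:
  assumes "s \<noteq> t"
  shows "xi_lap k s (wedge (xi_w k s) (xi_w k t) * lift_q k q) =
    4 * wedge xi_vec (xi_w k t) * lift_q k (euler_op k s q)
    + 4 * xi_norm * (wedge (xi_w k s) (xi_w k t) * lift_q k (bessel_op k s q))"
proof -
  have const: "xi_lap k s (xi_w k t $ a * P) = xi_w k t $ a * xi_lap k s P" for a P
    using assms by (intro xi_lap_mult_const) (simp add: pdiff_xi_w)
  have "wedge (xi_w k s) (xi_w k t) * lift_q k q =
      xi_w k t $ 2 * (xi_w k s $ 1 * lift_q k q) - xi_w k t $ 1 * (xi_w k s $ 2 * lift_q k q)"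
    by (simp add: wedge_def algebra_simps)
  then have "xi_lap k s (wedge (xi_w k s) (xi_w k t) * lift_q k q) =
      xi_w k t $ 2 * xi_lap k s (xi_w k s $ 1 * lift_q k q)
      - xi_w k t $ 1 * xi_lap k s (xi_w k s $ 2 * lift_q k q)"
    by (simp only: xi_lap_diff const)
  then show ?thesis
    unfolding xi_lap_w_mult_lift_q by (simp add: wedge_def right_diff_distrib distrib_left mult_ac)
qed

lemma xi_lap_wedge_right:
  assumes "s \<noteq> t"
  shows "xi_lap k t (wedge (xi_w k s) (xi_w k t) * lift_q k q) =
    4 * wedge (xi_w k s) xi_vec * lift_q k (euler_op k t q)
    + 4 * xi_norm * (wedge (xi_w k s) (xi_w k t) * lift_q k (bessel_op k t q))"
  using assms xi_lap_wedge_left[of t s k q]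
  by (simp add: wedge_swap[of "xi_w k s"] xi_lap_uminus)

lemma xi_lap_wedge_other:
  assumes "u \<noteq> s" "u \<noteq> t"
  shows "xi_lap k u (wedge (xi_w k s) (xi_w k t) * lift_q k (euler_op k u q)) =
    4 * xi_norm * (wedge (xi_w k s) (xi_w k t) * lift_q k (euler_op k u (bessel_op k u q)))"
proof -
  have "xi_lap k u (wedge (xi_w k s) (xi_w k t) * P) = wedge (xi_w k s) (xi_w k t) * xi_lap k u P" for P
    using assms by (intro xi_lap_mult_const) (simp add: pdiff_xi_w wedge_def)
  from this[of "lift_q k (euler_op k u q)"] show ?thesis
    unfolding xi_lap_lift_q laplace_euler_op by (simp only: mult_ac)
qed

text \<open>Each of the two indices in the area form contributes one first-order term, in which its \<open>w\<close> is
  replaced by \<open>v\<close>; the third index contributes none.\<close>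
lemma xi_laplacian_wedge:
  fixes k :: "nat ^ 't::finite"
  assumes "s \<noteq> t" "s \<noteq> u" "t \<noteq> u" and UNIV: "UNIV = {s, t, u}"
  shows "xi_laplacian k (wedge (xi_w k s) (xi_w k t) * lift_q k (euler_op k u q)) =
    4 * wedge xi_vec (xi_w k t) * lift_q k (euler_op k s (euler_op k u q))
    + 4 * wedge (xi_w k s) xi_vec * lift_q k (euler_op k t (euler_op k u q))
    + 4 * xi_norm * (wedge (xi_w k s) (xi_w k t)
        * lift_q k (euler_op k u (\<Sum>v\<in>UNIV. bessel_op k v q)))"
proof -
  have sum: "(\<Sum>v\<in>UNIV. f v) = f s + f t + f u" for f :: "'t \<Rightarrow> 'b::comm_monoid_add"
    using assms by (simp add: UNIV add_ac)
  show ?thesis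
    unfolding xi_laplacian_eq sum xi_lap_wedge_left[OF \<open>s \<noteq> t\<close>] xi_lap_wedge_right[OF \<open>s \<noteq> t\<close>]
      xi_lap_wedge_other[OF assms(2,3)[symmetric]]
    using assms(2,3) by (simp add: bessel_op_euler_op euler_op_add algebra_simps)
qed

lemma xi_pullback_Mop:
  "xi_pullback k (Mop k' q) = 2 * (
      wedge (xi_w k 1) (xi_w k 2) * lift_q k (euler_op k' 3 q)
    - wedge (xi_w k 1) (xi_w k 3) * lift_q k (euler_op k' 2 q)
    + wedge (xi_w k 2) (xi_w k 3) * lift_q k (euler_op k' 1 q))"
proof -
  have "xi_gram k s $ 2 $ 1 = xi_gram k s $ 1 $ 2" for s
    by (simp add: xi_gram_def mult.commute)
  then show ?thesis
    by (simp add: xi_pullback_def subst_rv_Mop Mform_def Let_def xi_w_def xi_q_def[abs_def]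
        algebra_simps)
qed

text \<open>The first-order terms, those with \<open>v\<close> in the area form, cancel in pairs between the three
  summands of \<open>M\<^sub>k\<close>: this is what the signs in its definition achieve. On what remains, the
  Laplacian acts through \<open>q\<close> alone.\<close>
lemma xi_laplacian_Mop:
  "xi_laplacian k (xi_pullback k (Mop k q)) =
     4 * xi_norm * xi_pullback k (Mop k (\<Sum>s\<in>UNIV. bessel_op k s q))"
proof -
  have ne: "(1::3) \<noteq> 2" "(1::3) \<noteq> 3" "(2::3) \<noteq> 3" by simp_all
  have U: "UNIV = {1, 2, 3::3}" "UNIV = {1, 3, 2::3}" "UNIV = {2, 3, 1::3}"
    using UNIV_3 by auto
  note W = xi_laplacian_wedge[OF ne(1,2,3) U(1)] xi_laplacian_wedge[OF ne(2,1) ne(3)[symmetric] U(2)]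
    xi_laplacian_wedge[OF ne(3) ne(1,2)[symmetric] U(3)]
  show ?thesis
    unfolding xi_pullback_Mop mult_2 xi_laplacian_simps W
    \<comment> \<open>each product of two different \<open>D\<^sub>s\<close> now occurs in two first-order terms of opposite sign\<close>
    by (simp add: wedge_swap[of _ xi_vec] algebra_simps
       euler_op_commute[of k 3 1] euler_op_commute[of k 3 2] euler_op_commute[of k 2 1])
qed

section \<open>The polynomial \<open>p\<close> and the conclusion\<close>

text \<open>Since \<open>B\<^sub>s\<close> sends \<open>r\<^sub>s\<^sup>n\<close> to \<open>n (n + k\<^sub>s) r\<^sub>s\<^bsup>n-1\<^esup>\<close>, the equation is a two-term recursion for the
  coefficients of \<open>p\<close>. The alternating binomial coefficients supply the factors \<open>i\<close> and
  \<open>j/2 - i\<close>, the falling factorials the factors shifted by \<open>k\<^sub>1\<close> and \<open>k\<^sub>2\<close>.\<close>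
lemma bessel_op_p_shift:
  fixes k :: "nat ^ 3"
  shows "(\<Sum>s\<in>UNIV. bessel_op k s (p_shift j (k $ 1) (k $ 2))) = 0"
proof -
  let ?N = "j div 2"
  define c :: "nat \<Rightarrow> complex" where
    "c i = (-1) ^ i * of_nat (?N choose i) * ffact (of_nat (k $ 1 + ?N)) i
      * ffact (of_nat (k $ 2 + ?N)) (?N - i)" for i
  have p: "p_shift j (k $ 1) (k $ 2) =
      (\<Sum>i\<le>?N. Const (c i) * Indet 1 ^ (?N - i) * Indet 2 ^ i)"
    by (simp add: p_shift_def c_def)
  have step: "c i * of_nat ((?N - i) * (?N - i + k $ 1))
      + c (Suc i) * of_nat (Suc i * (Suc i + k $ 2)) = 0" if "i < ?N" for i
  proof -
    obtain m where N: "?N = Suc (i + m)" using less_imp_Suc_add[OF \<open>i < ?N\<close>] by blast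
    have "Suc i * (?N choose Suc i) = (?N - i) * (?N choose i)"
      by (simp only: binomial_absorption binomial_absorb_comp)
    also have "?N - i = Suc m"
      using N by simp
    finally have "of_nat (Suc i) * of_nat (?N choose Suc i) =
        (of_nat (Suc m) * of_nat (?N choose i) :: complex)"
      by (metis of_nat_mult)
    moreover have ffact_Suc: "ffact x (Suc n) = ffact x n * (x - of_nat n)" for x :: complex and n
      by (simp add: ffact_def)
    moreover have "c i * of_nat ((?N - i) * (?N - i + k $ 1))
        + c (Suc i) * of_nat (Suc i * (Suc i + k $ 2)) =
      (-1) ^ i * ffact (of_nat (k $ 1 + ?N)) i * ffact (of_nat (k $ 2 + ?N)) m
        * of_nat (k $ 1 + Suc m) * of_nat (k $ 2 + Suc i)
        * (of_nat (Suc m) * of_nat (?N choose i) - of_nat (Suc i) * of_nat (?N choose Suc i))"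
      unfolding c_def N by (simp add: ffact_Suc algebra_simps del: binomial_Suc_Suc)
    ultimately show ?thesis by simp
  qed
  have b1: "bessel_op k 1 (Const d * Indet 1 ^ a * Indet 2 ^ b) =
      Const (d * of_nat (a * (a + k $ 1))) * Indet 1 ^ (a - 1) * Indet 2 ^ b" for d a b
  proof -
    have "bessel_op k 1 ((Const d * Indet 2 ^ b) * Indet 1 ^ a) =
        (Const d * Indet 2 ^ b) * bessel_op k 1 (Indet 1 ^ a)"
      by (rule bessel_op_mult_const) (simp add: pdiff_power)
    then show ?thesis by (simp add: bessel_op_power Const_mult Const_add mult_ac)
  qed
  have b2: "bessel_op k 2 (Const d * Indet 1 ^ a * Indet 2 ^ b) =
      Const (d * of_nat (b * (b + k $ 2))) * Indet 1 ^ a * Indet 2 ^ (b - 1)" for d a b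
  proof -
    have "bessel_op k 2 ((Const d * Indet 1 ^ a) * Indet 2 ^ b) =
        (Const d * Indet 1 ^ a) * bessel_op k 2 (Indet 2 ^ b)"
      by (rule bessel_op_mult_const) (simp add: pdiff_power)
    then show ?thesis by (simp add: bessel_op_power Const_mult Const_add mult_ac)
  qed
  have b3: "bessel_op k 3 (Const d * Indet 1 ^ a * Indet 2 ^ b) = 0" for d a b
    by (simp add: bessel_op_def pdiff_power)
  \<comment> \<open>The term of index \<open>i\<close> under \<open>B\<^sub>1\<close> meets the term of index \<open>i + 1\<close> under \<open>B\<^sub>2\<close>. The leftover terms, with
    \<open>i = j/2\<close> and \<open>i = 0\<close> respectively, have the factor 0.\<close>
  have "bessel_op k 1 (p_shift j (k $ 1) (k $ 2)) =
      (\<Sum>i<?N. Const (c i * of_nat ((?N - i) * (?N - i + k $ 1)))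
        * Indet 1 ^ (?N - Suc i) * Indet 2 ^ i)"
    unfolding p bessel_op_sum b1 by (simp add: lessThan_Suc_atMost[symmetric])
  moreover have "bessel_op k 2 (p_shift j (k $ 1) (k $ 2)) =
      (\<Sum>i<?N. Const (c (Suc i) * of_nat (Suc i * (Suc i + k $ 2)))
        * Indet 1 ^ (?N - Suc i) * Indet 2 ^ i)"
    unfolding p bessel_op_sum b2
    by (simp only: lessThan_Suc_atMost[symmetric] sum.lessThan_Suc_shift) simp
  moreover have "bessel_op k 3 (p_shift j (k $ 1) (k $ 2)) = 0"
    unfolding p bessel_op_sum b3 by simp
  ultimately have "(\<Sum>s\<in>UNIV. bessel_op k s (p_shift j (k $ 1) (k $ 2))) =
      (\<Sum>i<?N. Const (c i * of_nat ((?N - i) * (?N - i + k $ 1))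
          + c (Suc i) * of_nat (Suc i * (Suc i + k $ 2)))
        * Indet 1 ^ (?N - Suc i) * Indet 2 ^ i)"
    by (simp only: sum_3 add_0_right Const_add distrib_right sum.distrib)
  also have "\<dots> = 0"
    by (intro sum.neutral ballI) (simp only: lessThan_iff step Const_simps mult_zero_left)
  finally show ?thesis .
qed

theorem proposition2p2:
  fixes k :: "nat ^ 3" and j :: nat
  assumes "\<And>s. k $ s > 0" and "even j"
  shows "RC_polynomial (j + 2) 1 k (Mop k (p_shift j (k $ 1) (k $ 2)))"
proof -
  let ?p = "p_shift j (k $ 1) (k $ 2)"
  have "Mop k ?p \<in> HR (2 * (j div 2) + 2)"
    by (rule Mop_HR) (rule keys_p_shift)
  then have "Mop k ?p \<in> HR (j + 2)"
    using \<open>even j\<close> by simp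
  then have "rho_homogeneous (j + 2) 1 (Mop k ?p)"
    unfolding rho_homogeneous_def using Mop_equivariant by (simp del: transpose_matrix_vector)
  moreover have "Mop k (0 :: 3 cpoly) = 0"
    by (simp add: Mop_def Psi_def)
  then have "k_harmonic k (Mop k ?p)"
    unfolding k_harmonic_def xi_laplacian_Mop bessel_op_p_shift
    by (simp add: xi_pullback_def subst_rv_def)
  ultimately show ?thesis by (simp add: RC_polynomial_def)
qed

end
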